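(* Let $\mathbb{F}$ be a field and $d\ge 0$ an integer. Let $\Psi=(\mathcal{C};\{x_i\}_{i=0}^d;\{e_i\}_{i=0}^d)$ denote a character system over $\mathbb{F}$. For $0\le i\le d$ define $E_i,E^*_i\in\mathrm{End}(\mathcal{C})$ (the algebra of $\mathbb{F}$-linear maps $\mathcal{C}\to\mathcal{C}$) such that $E_ie_j=\delta_{i,j}e_j$ and $E^*_ix_j=\delta_{i,j}x_j$ for $0\le j\le d$. Then the sequence $\Phi_\Psi=(\{E_i\}_{i=0}^d;\{E^*_i\}_{i=0}^d)$ is a symmetric idempotent system in $\mathrm{End}(\mathcal{C})$ whose first eigenmatrix is the eigenmatrix of $\Psi$.
   Context: All algebras are associative, unital, over $\mathbb{F}$. For bases $\{u_i\}_{i=0}^d$, $\{v_i\}_{i=0}^d$ of a vector space, the transition matrix from $\{u_i\}$ to $\{v_i\}$ is the matrix $P$ with $v_j=\sum_{i=0}^d P_{i,j}u_i$. Idempotent systems. Let $\mathcal{A}$ be an algebra isomorphic to the matrix algebra $\mathrm{Mat}_{d+1}(\mathbb{F})$ (rank of an element means the rank of its image under such an isomorphism). A system of mutually orthogonal rank $1$ idempotents in $\mathcal{A}$ is a sequence $\{E_i\}_{i=0}^d$ with $E_iE_j = \delta_{i,j}E_i$ and $\mathrm{rank}(E_i)=1$ for $0\le i,j\le d$. An idempotent system in $\mathcal{A}$ is a sequence $\Phi = (\{E_i\}_{i=0}^d; \{E^*_i\}_{i=0}^d)$ such that $\{E_i\}_{i=0}^d$ and $\{E^*_i\}_{i=0}^d$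 are systems of mutually orthogonal rank $1$ idempotents in $\mathcal{A}$, $E_0E^*_iE_0 \neq 0$ and $E^*_0E_iE^*_0\neq 0$ for $0\le i\le d$. $\Phi$ is symmetric if there is an antiautomorphism of $\mathcal{A}$ (an $\mathbb{F}$-linear bijection $\tau$ with $(YZ)^\tau = Z^\tau Y^\tau$) that fixes each $E_i$ and $E^*_i$. For symmetric $\Phi$, $\{E_i\}_{i=0}^d$ is a basis of a commutative subalgebra $\mathcal{M}$ of $\mathcal{A}$; for $0\le i\le d$ there is a unique $A_i\in\mathcal{M}$ with $A_iE^*_0E_0=E^*_iE_0$, and $\{A_i\}_{i=0}^d$ is a basis of $\mathcal{M}$. The first eigenmatrix of $\Phi$ is the transition matrix from $\{E_i\}_{i=0}^d$ to $\{A_i\}_{i=0}^d$. Character systems. A character algebra over $\mathbb{F}$ with diameter $d$ is a sequence $(\mathcal{C};\{x_i\}_{i=0}^d)$ where $\mathcal{C}$ is a commutative $\mathbb{F}$-algebra and $x_i\in\mathcal{C}$ satisfy: (i) $x_0=1$; (ii) $\{x_i\}_{i=0}^d$ is a basis of $\mathcal{C}$; (iii) writing $x_ix_j=\sum_{h=0}^d p^h_{ij}x_h$, there are nonzero scalars $\{k_i\}_{i=0}^d$ with $p^0_{ij}=\delta_{i,j}k_i$ for $0\le i,j\le d$; (iv) there is an algebra homomorphism $\varphi:\mathcal{C}\to\mathbb{F}$ with $\varphi(x_i)=k_i$ for $0\le i\le d$. It is semisimple if $\mathcal{C}$ has a basis $\{e_i\}_{i=0}^d$ with $e_ie_j=\delta_{i,j}e_i$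 and $1=\sum_{i=0}^d e_i$; these $e_i$ (unique up to permutation) are the primitive idempotents. Exactly one primitive idempotent is not sent to $0$ by $\varphi$; it is called trivial. A character system over $\mathbb{F}$ with diameter $d$ is a sequence $\Psi=(\mathcal{C};\{x_i\}_{i=0}^d;\{e_i\}_{i=0}^d)$ where $(\mathcal{C};\{x_i\}_{i=0}^d)$ is a semisimple character algebra over $\mathbb{F}$ and $\{e_i\}_{i=0}^d$ is an ordering of the primitive idempotents with $e_0$ trivial. The eigenmatrix of $\Psi$ is the transition matrix from $\{e_i\}_{i=0}^d$ to $\{x_i\}_{i=0}^d$. *)

theory Defs
  imports "Jordan_Normal_Form.DL_Rank" "HOL-Algebra.QuotRing"
begin

text \<open>
  The ground field is a type \<open>'f :: field\<close>, turned into a structure by \<open>class_ring\<close>.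
  Algebras and vector spaces over it are structures of record type \<open>module\<close>.
  A sequence indexed by \<open>0, \<dots>, d\<close> is a function on \<open>nat\<close> of which only the values at
  indices \<open>\<le> d\<close> matter; all predicates below take the diameter \<open>d\<close> as an argument.
\<close>


section \<open>Bases and transition matrices\<close>

definition indexed_basis :: "('f::field, 'v, 'm) module_scheme \<Rightarrow> nat \<Rightarrow> (nat \<Rightarrow> 'v) \<Rightarrow> bool" where
  "indexed_basis V d u \<longleftrightarrow>
     vectorspace class_ring V \<and> inj_on u {..d} \<and> vectorspace.basis class_ring V (u ` {..d})"

text \<open>Only meaningful when \<open>u\<close> is a basis of a subspace containing all \<open>v j\<close>.\<close>

definition transition_matrix ::
    "('f::field, 'v, 'm) module_scheme \<Rightarrow> nat \<Rightarrow> (nat \<Rightarrow> 'v) \<Rightarrow> (nat \<Rightarrow> 'v) \<Rightarrow> 'f mat" where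
  "transition_matrix V d u v =
     (THE P. P \<in> carrier_mat (d + 1) (d + 1) \<and>
        (\<forall>j\<le>d. v j = (\<Oplus>\<^bsub>V\<^esub>i\<in>{..d}. P $$ (i, j) \<odot>\<^bsub>V\<^esub> u i)))"


section \<open>Algebras\<close>

text \<open>The library's \<open>algebra\<close> is commutative; this is the version without commutativity.\<close>

definition assoc_algebra :: "('f::field, 'a, 'm) module_scheme \<Rightarrow> bool" where
  "assoc_algebra A \<longleftrightarrow>
     ring A \<and> module class_ring A \<and>
     (\<forall>c. \<forall>y\<in>carrier A. \<forall>z\<in>carrier A.
        (c \<odot>\<^bsub>A\<^esub> y) \<otimes>\<^bsub>A\<^esub> z = c \<odot>\<^bsub>A\<^esub> (y \<otimes>\<^bsub>A\<^esub> z) \<and>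
        y \<otimes>\<^bsub>A\<^esub> (c \<odot>\<^bsub>A\<^esub> z) = c \<odot>\<^bsub>A\<^esub> (y \<otimes>\<^bsub>A\<^esub> z))"

definition algebra_iso ::
    "('f::field, 'a, 'm) module_scheme \<Rightarrow> ('f, 'b, 'n) module_scheme \<Rightarrow> ('a \<Rightarrow> 'b) set" where
  "algebra_iso A B = ring_iso A B \<inter> LinearCombinations.module_hom class_ring A B"

abbreviation mat_algebra :: "nat \<Rightarrow> ('f::field, 'f mat) module" where
  "mat_algebra n \<equiv> module_mat TYPE('f) n n"

definition antiautomorphism :: "('f::field, 'a, 'm) module_scheme \<Rightarrow> ('a \<Rightarrow> 'a) \<Rightarrow> bool" where
  "antiautomorphism A \<tau> \<longleftrightarrow>
     \<tau> \<in> LinearCombinations.module_hom class_ring A A \<and> bij_betw \<tau> (carrier A) (carrier A) \<and>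
     (\<forall>y\<in>carrier A. \<forall>z\<in>carrier A. \<tau> (y \<otimes>\<^bsub>A\<^esub> z) = \<tau> z \<otimes>\<^bsub>A\<^esub> \<tau> y)"

text \<open>
  The rank of an element of an algebra isomorphic to the algebra of \<open>n \<times> n\<close> matrices.
  The choice of the isomorphism is immaterial, since the automorphisms of a matrix algebra
  are inner.
\<close>

definition alg_rank :: "nat \<Rightarrow> ('f::field, 'a, 'm) module_scheme \<Rightarrow> 'a \<Rightarrow> nat" where
  "alg_rank n A a = vec_space.rank n ((SOME h. h \<in> algebra_iso A (mat_algebra n)) a)"

text \<open>
  The algebra of linear maps on \<open>V\<close>. As for \<open>BijGroup\<close>, maps are taken to be extensional,
  so that a linear map is determined by its values on the carrier.
\<close>

definition End_algebra :: "('f::field, 'v, 'm) module_scheme \<Rightarrow> ('f, 'v \<Rightarrow> 'v) module" where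
  "End_algebra V = \<lparr>
     carrier = LinearCombinations.module_hom class_ring V V \<inter> extensional (carrier V),
     mult = (\<lambda>f g. compose (carrier V) f g),
     one = (\<lambda>v\<in>carrier V. v),
     zero = (\<lambda>v\<in>carrier V. \<zero>\<^bsub>V\<^esub>),
     add = (\<lambda>f g. \<lambda>v\<in>carrier V. f v \<oplus>\<^bsub>V\<^esub> g v),
     smult = (\<lambda>c f. \<lambda>v\<in>carrier V. c \<odot>\<^bsub>V\<^esub> f v)\<rparr>"


section \<open>Idempotent systems\<close>

definition orthogonal_rank1_idempotents ::
    "('f::field, 'a, 'm) module_scheme \<Rightarrow> nat \<Rightarrow> (nat \<Rightarrow> 'a) \<Rightarrow> bool" where
  "orthogonal_rank1_idempotents A d E \<longleftrightarrow>
     (\<forall>i\<le>d. E i \<in> carrier A \<and> alg_rank (d + 1) A (E i) = 1) \<and>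
     (\<forall>i\<le>d. \<forall>j\<le>d. E i \<otimes>\<^bsub>A\<^esub> E j = (if i = j then E i else \<zero>\<^bsub>A\<^esub>))"

definition idempotent_system ::
    "('f::field, 'a, 'm) module_scheme \<Rightarrow> nat \<Rightarrow> (nat \<Rightarrow> 'a) \<Rightarrow> (nat \<Rightarrow> 'a) \<Rightarrow> bool" where
  "idempotent_system A d E Es \<longleftrightarrow>
     assoc_algebra A \<and> algebra_iso A (mat_algebra (d + 1) :: ('f, 'f mat) module) \<noteq> {} \<and>
     orthogonal_rank1_idempotents A d E \<and>
     orthogonal_rank1_idempotents A d Es \<and>
     (\<forall>i\<le>d. E 0 \<otimes>\<^bsub>A\<^esub> Es i \<otimes>\<^bsub>A\<^esub> E 0 \<noteq> \<zero>\<^bsub>A\<^esub>) \<and>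
     (\<forall>i\<le>d. Es 0 \<otimes>\<^bsub>A\<^esub> E i \<otimes>\<^bsub>A\<^esub> Es 0 \<noteq> \<zero>\<^bsub>A\<^esub>)"

definition symmetric_idempotent_system ::
    "('f::field, 'a, 'm) module_scheme \<Rightarrow> nat \<Rightarrow> (nat \<Rightarrow> 'a) \<Rightarrow> (nat \<Rightarrow> 'a) \<Rightarrow> bool" where
  "symmetric_idempotent_system A d E Es \<longleftrightarrow>
     idempotent_system A d E Es \<and>
     (\<exists>\<tau>. antiautomorphism A \<tau> \<and> (\<forall>i\<le>d. \<tau> (E i) = E i \<and> \<tau> (Es i) = Es i))"

text \<open>
  The element \<open>A\<^sub>i\<close> of the subalgebra \<open>\<M> = span {E\<^sub>0, \<dots>, E\<^sub>d}\<close>; it exists and is unique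
  for a symmetric idempotent system.
\<close>

definition system_A ::
    "('f::field, 'a, 'm) module_scheme \<Rightarrow> nat \<Rightarrow> (nat \<Rightarrow> 'a) \<Rightarrow> (nat \<Rightarrow> 'a) \<Rightarrow> nat \<Rightarrow> 'a" where
  "system_A A d E Es i =
     (THE a. a \<in> LinearCombinations.module.span class_ring A (E ` {..d}) \<and>
             a \<otimes>\<^bsub>A\<^esub> Es 0 \<otimes>\<^bsub>A\<^esub> E 0 = Es i \<otimes>\<^bsub>A\<^esub> E 0)"

definition first_eigenmatrix ::
    "('f::field, 'a, 'm) module_scheme \<Rightarrow> nat \<Rightarrow> (nat \<Rightarrow> 'a) \<Rightarrow> (nat \<Rightarrow> 'a) \<Rightarrow> 'f mat" where
  "first_eigenmatrix A d E Es = transition_matrix A d E (system_A A d E Es)"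


section \<open>Character systems\<close>

text \<open>
  The conditions on the structure constants \<open>p h i j\<close> (mathematically, p with upper index
  \<open>h\<close> and lower indices \<open>i\<close>, \<open>j\<close>) and on \<open>\<phi>\<close> in the definition of a character algebra, as a
  predicate of \<open>\<phi>\<close>, because \<open>\<phi>\<close> is needed again to say which primitive idempotent is trivial.
  If the \<open>x i\<close> form a basis, then the structure constants \<open>p h i j\<close>, hence the
  scalars \<open>k i\<close> and the linear map \<open>\<phi>\<close>, are uniquely determined.
\<close>

definition character_hom ::
    "('f::field, 'c, 'm) module_scheme \<Rightarrow> nat \<Rightarrow> (nat \<Rightarrow> 'c) \<Rightarrow> ('c \<Rightarrow> 'f) \<Rightarrow> bool" where
  "character_hom C d x \<phi> \<longleftrightarrow>
     (\<exists>(p :: nat \<Rightarrow> nat \<Rightarrow> nat \<Rightarrow> 'f) (k :: nat \<Rightarrow> 'f).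
        (\<forall>i\<le>d. \<forall>j\<le>d. x i \<otimes>\<^bsub>C\<^esub> x j = (\<Oplus>\<^bsub>C\<^esub>h\<in>{..d}. p h i j \<odot>\<^bsub>C\<^esub> x h)) \<and>
        (\<forall>i\<le>d. k i \<noteq> 0) \<and>
        (\<forall>i\<le>d. \<forall>j\<le>d. p 0 i j = (if i = j then k i else 0)) \<and>
        \<phi> \<in> Ring.ring_hom C class_ring \<and>
        (\<forall>c. \<forall>y\<in>carrier C. \<phi> (c \<odot>\<^bsub>C\<^esub> y) = c * \<phi> y) \<and>
        (\<forall>i\<le>d. \<phi> (x i) = k i))"

definition character_algebra ::
    "('f::field, 'c, 'm) module_scheme \<Rightarrow> nat \<Rightarrow> (nat \<Rightarrow> 'c) \<Rightarrow> bool" where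
  "character_algebra C d x \<longleftrightarrow>
     algebra class_ring C \<and> x 0 = \<one>\<^bsub>C\<^esub> \<and> indexed_basis C d x \<and>
     (\<exists>\<phi>. character_hom C d x \<phi>)"

definition primitive_idempotents ::
    "('f::field, 'c, 'm) module_scheme \<Rightarrow> nat \<Rightarrow> (nat \<Rightarrow> 'c) \<Rightarrow> bool" where
  "primitive_idempotents C d e \<longleftrightarrow>
     indexed_basis C d e \<and>
     (\<forall>i\<le>d. \<forall>j\<le>d. e i \<otimes>\<^bsub>C\<^esub> e j = (if i = j then e i else \<zero>\<^bsub>C\<^esub>)) \<and>
     \<one>\<^bsub>C\<^esub> = (\<Oplus>\<^bsub>C\<^esub>i\<in>{..d}. e i)"

text \<open>
  Semisimplicity of the character algebra is witnessed by the sequence \<open>e\<close> itself; the last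
  conjunct says that \<open>e 0\<close> is the trivial primitive idempotent.
\<close>

definition character_system ::
    "('f::field, 'c, 'm) module_scheme \<Rightarrow> nat \<Rightarrow> (nat \<Rightarrow> 'c) \<Rightarrow> (nat \<Rightarrow> 'c) \<Rightarrow> bool" where
  "character_system C d x e \<longleftrightarrow>
     character_algebra C d x \<and> primitive_idempotents C d e \<and>
     (\<exists>\<phi>. character_hom C d x \<phi> \<and> \<phi> (e 0) \<noteq> 0)"

definition eigenmatrix ::
    "('f::field, 'c, 'm) module_scheme \<Rightarrow> nat \<Rightarrow> (nat \<Rightarrow> 'c) \<Rightarrow> (nat \<Rightarrow> 'c) \<Rightarrow> 'f mat" where
  "eigenmatrix C d x e = transition_matrix C d e x"


section \<open>The idempotents of \<open>End\<close> attached to a basis\<close>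

definition basis_idempotent ::
    "('f::field, 'v, 'm) module_scheme \<Rightarrow> nat \<Rightarrow> (nat \<Rightarrow> 'v) \<Rightarrow> nat \<Rightarrow> 'v \<Rightarrow> 'v" where
  "basis_idempotent V d u i =
     (THE f. f \<in> carrier (End_algebra V) \<and>
             (\<forall>j\<le>d. f (u j) = (if i = j then u j else \<zero>\<^bsub>V\<^esub>)))"

end

theory Submission
  imports Defs
begin

text \<open>
  Let \<open>t\<close> be the functional on \<open>C\<close> reading off the coefficient of \<open>x\<^sub>0 = 1\<close>, and consider the
  bilinear form \<open>B(y, z) = t(yz)\<close>. It is symmetric, and both \<open>x\<close> and \<open>e\<close> are orthogonal bases for
  it: \<open>B(x\<^sub>i, x\<^sub>j) = \<delta>\<^sub>i\<^sub>j k\<^sub>i\<close> by the axioms of a character algebra, and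
  \<open>B(e\<^sub>i, e\<^sub>j) = \<delta>\<^sub>i\<^sub>j m\<^sub>i\<close> with \<open>m\<^sub>i = t(e\<^sub>i)\<close>. As all \<open>k\<^sub>i\<close> are nonzero, \<open>B\<close> is nondegenerate, so
  all \<open>m\<^sub>i\<close> are nonzero too, and the adjoint with respect to \<open>B\<close> is an antiautomorphism of
  \<open>End(C)\<close> fixing every \<open>E\<^sub>i\<close> and every \<open>E\<^sup>*\<^sub>i\<close>. Triviality of \<open>e\<^sub>0\<close> says that \<open>k\<^sub>i\<close> is the
  \<open>e\<^sub>0\<close>-coordinate of \<open>x\<^sub>i\<close>; hence \<open>E\<^sub>0 E\<^sup>*\<^sub>i E\<^sub>0\<close> sends \<open>e\<^sub>0\<close> to \<open>k\<^sub>i m\<^sub>0 e\<^sub>0\<close>, while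
  \<open>E\<^sup>*\<^sub>0 E\<^sub>i E\<^sup>*\<^sub>0\<close> sends \<open>x\<^sub>0\<close> to \<open>m\<^sub>i x\<^sub>0\<close>. Finally \<open>E\<^sub>i\<close> is multiplication by \<open>e\<^sub>i\<close>, so the span of
  the \<open>E\<^sub>i\<close> consists of the multiplication maps, and \<open>A\<^sub>i\<close> is multiplication by \<open>x\<^sub>i\<close>.
\<close>

section \<open>Coordinates with respect to a basis\<close>

locale class_vectorspace =
  fixes V :: "('f::field, 'v, 'm) module_scheme" (structure)
  assumes vectorspace_class_ring: "vectorspace class_ring V"
begin

text \<open>The rewrites identify the operations of \<open>class_ring\<close> with those of the type
  class, so that coefficients obey ordinary field arithmetic.\<close>

sublocale vectorspace "class_ring :: 'f ring" V
  rewrites "carrier (class_ring :: 'f ring) = UNIV"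
    and "monoid.mult (class_ring :: 'f ring) = (*)"
    and "add (class_ring :: 'f ring) = (+)"
    and "one (class_ring :: 'f ring) = 1"
    and "zero (class_ring :: 'f ring) = 0"
    and "a_inv (class_ring :: 'f ring) = uminus"
    and "a_minus (class_ring :: 'f ring) = minus"
    and "finsum (class_ring :: 'f ring) = sum"
  using vectorspace_class_ring by (simp_all add: class_ring_simps)

definition linear_form :: "('v \<Rightarrow> 'f) \<Rightarrow> bool" where
  "linear_form \<phi> \<longleftrightarrow> (\<forall>v\<in>carrier V. \<forall>w\<in>carrier V. \<phi> (v \<oplus> w) = \<phi> v + \<phi> w) \<and>
     (\<forall>c. \<forall>v\<in>carrier V. \<phi> (c \<odot> v) = c * \<phi> v)"

lemma linear_form_finsum:
  assumes "linear_form \<phi>" "finite S" "\<And>i. i \<in> S \<Longrightarrow> g i \<in> carrier V"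
  shows "\<phi> (\<Oplus>i\<in>S. g i) = (\<Sum>i\<in>S. \<phi> (g i))"
  using assms(2,3)
proof (induction S)
  case empty
  have "\<phi> (0 \<odot> \<zero>) = 0 * \<phi> \<zero>" using assms(1) unfolding linear_form_def by blast
  then show ?case by simp
next
  case (insert s S)
  then have "(\<Oplus>i\<in>S. g i) \<in> carrier V" by (intro M.finsum_closed) auto
  then show ?case using insert assms(1) by (simp add: linear_form_def Pi_def)
qed

lemma finsum_in_span:
  assumes S: "S \<subseteq> carrier V" and "finite I" "\<And>i. i \<in> I \<Longrightarrow> v i \<in> S"
  shows "(\<Oplus>i\<in>I. c i \<odot> v i) \<in> span S"
  using assms(2,3)
proof (induction I)
  case empty
  then show ?case by (simp add: span_zero)
next
  case (insert i I)
  have "c i \<odot> v i \<in> span S"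
    using insert S submodule.smult_closed[OF span_is_submodule[OF S], of "c i" "v i"]
    by (simp add: span_mem class_ring_simps)
  moreover have "(\<lambda>i. c i \<odot> v i) \<in> I \<rightarrow> carrier V" "c i \<odot> v i \<in> carrier V"
    using insert S by auto
  ultimately show ?case using insert S by (simp add: span_add1)
qed

end

locale based_space = class_vectorspace V
  for V :: "('f::field, 'v, 'm) module_scheme" (structure) +
  fixes d :: nat and u :: "nat \<Rightarrow> 'v"
  assumes indexed_basis: "indexed_basis V d u"
begin

lemma u_closed [simp, intro]: "i \<le> d \<Longrightarrow> u i \<in> carrier V"
  using indexed_basis by (auto simp: indexed_basis_def basis_def)

text \<open>In contrast to \<open>lincomb\<close>, coefficients are attached to indices instead of
  vectors, as in the sums of \<open>transition_matrix\<close>.\<close>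

definition comb :: "(nat \<Rightarrow> 'f) \<Rightarrow> 'v" where
  "comb a = (\<Oplus>i\<in>{..d}. a i \<odot> u i)"

lemma comb_closed [simp, intro]: "comb a \<in> carrier V"
  by (auto simp: comb_def intro!: M.finsum_closed)

lemma comb_add: "comb a \<oplus> comb b = comb (\<lambda>i. a i + b i)"
proof -
  have "comb (\<lambda>i. a i + b i) = (\<Oplus>i\<in>{..d}. a i \<odot> u i \<oplus> b i \<odot> u i)"
    unfolding comb_def by (intro M.finsum_cong') (auto simp: smult_l_distr)
  then show ?thesis
    unfolding comb_def by (simp add: Pi_def M.finsum_addf)
qed

lemma comb_smult: "c \<odot> comb a = comb (\<lambda>i. c * a i)"
proof -
  have "c \<odot> comb a = (\<Oplus>i\<in>{..d}. c \<odot> (a i \<odot> u i))"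
    unfolding comb_def by (rule finsum_smult) auto
  also have "\<dots> = comb (\<lambda>i. c * a i)"
    unfolding comb_def by (intro M.finsum_cong') (auto simp: smult_assoc1)
  finally show ?thesis .
qed

lemma lincomb_image: "lincomb b (u ` {..d}) = comb (\<lambda>i. b (u i))"
proof -
  have "inj_on u {..d}" using indexed_basis by (simp add: indexed_basis_def)
  then show ?thesis
    unfolding lincomb_def comb_def by (subst M.finsum_reindex) auto
qed

lemma comb_eq_zero:
  assumes "comb a = \<zero>" "i \<le> d" shows "a i = 0"
proof (rule ccontr)
  assume ne: "a i \<noteq> 0"
  have inj: "inj_on u {..d}" using indexed_basis by (simp add: indexed_basis_def)
  \<comment> \<open>Linear dependence is phrased with coefficients attached to vectors, so
    \<open>a\<close> is transported along the inverse of \<open>u\<close>.\<close>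
  define b where "b = (\<lambda>v. a (the_inv_into {..d} u v))"
  have b: "b (u j) = a j" if "j \<le> d" for j
    using inj that by (simp add: b_def the_inv_into_f_f)
  have "lincomb b (u ` {..d}) = comb a"
    unfolding lincomb_image unfolding comb_def by (intro M.finsum_cong') (auto simp: b)
  then have "lin_dep (u ` {..d})"
    using assms ne b by (intro lin_dep_crit[of "u ` {..d}" _ b "u i"]) auto
  then show False using indexed_basis by (auto simp: indexed_basis_def basis_def)
qed

lemma comb_inject:
  assumes "comb a = comb b" "i \<le> d" shows "a i = b i"
proof -
  have "comb (\<lambda>i. a i + (- 1) * b i) = comb a \<oplus> (- 1) \<odot> comb b"
    by (simp only: comb_add comb_smult)
  also have "\<dots> = comb a \<oplus> (- 1) \<odot> comb a" by (simp only: assms(1))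
  also have "\<dots> = comb (\<lambda>i. 0)" by (simp add: comb_add comb_smult)
  also have "\<dots> = \<zero>" by (auto simp: comb_def intro!: M.add.finprod_one_eqI)
  finally show ?thesis using comb_eq_zero[OF _ assms(2)] by fastforce
qed

lemma ex_comb:
  assumes "v \<in> carrier V" shows "\<exists>a. v = comb a"
proof -
  have "v \<in> span (u ` {..d})"
    using assms indexed_basis by (simp add: indexed_basis_def basis_def)
  then obtain b where "lincomb b (u ` {..d}) = v"
    using finite_in_span[of "u ` {..d}" v] by auto
  then show ?thesis by (auto simp: lincomb_image)
qed

text \<open>\<open>coord i v\<close> is only specified for \<open>i \<le> d\<close> and \<open>v\<close> in the carrier.\<close>

definition coord :: "nat \<Rightarrow> 'v \<Rightarrow> 'f" where
  "coord i v = (SOME a. v = comb a) i"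

lemma comb_coord: "v \<in> carrier V \<Longrightarrow> comb (\<lambda>i. coord i v) = v"
  unfolding coord_def using someI_ex[OF ex_comb] by simp

lemma coord_comb [simp]: "i \<le> d \<Longrightarrow> coord i (comb a) = a i"
  using comb_inject[OF comb_coord[of "comb a"]] by auto

lemma coord_eqI:
  assumes "v \<in> carrier V" "w \<in> carrier V" "\<And>i. i \<le> d \<Longrightarrow> coord i v = coord i w"
  shows "v = w"
proof -
  have "comb (\<lambda>i. coord i v) = comb (\<lambda>i. coord i w)"
    unfolding comb_def using assms by (intro M.finsum_cong') auto
  then show ?thesis using assms comb_coord by simp
qed

lemma coord_add:
  assumes "i \<le> d" "v \<in> carrier V" "w \<in> carrier V"
  shows "coord i (v \<oplus> w) = coord i v + coord i w"
  using assms ex_comb[of v] ex_comb[of w] by (auto simp: comb_add)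

lemma coord_smult:
  assumes "i \<le> d" "v \<in> carrier V"
  shows "coord i (c \<odot> v) = c * coord i v"
  using assms ex_comb[of v] by (auto simp: comb_smult)

lemma coord_zero: "i \<le> d \<Longrightarrow> coord i \<zero> = 0"
  using coord_smult[of i \<zero> 0] by simp

lemma coord_u:
  assumes "i \<le> d" "j \<le> d" shows "coord i (u j) = (if i = j then 1 else 0)"
proof -
  have "comb (\<lambda>k. if k = j then 1 else 0) = (\<Oplus>k\<in>{..d}. if j = k then u k else \<zero>)"
    unfolding comb_def by (intro M.finsum_cong') auto
  also have "\<dots> = u j" using assms by (intro M.finsum_singleton) auto
  finally show ?thesis using assms coord_comb[of i "\<lambda>k. if k = j then 1 else 0"] by simp
qed

lemma u_nonzero: "i \<le> d \<Longrightarrow> u i \<noteq> \<zero>"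
  using coord_u[of i i] coord_zero[of i] by auto

lemma linear_form_coord: "i \<le> d \<Longrightarrow> linear_form (coord i)"
  by (simp add: linear_form_def coord_add coord_smult)

lemma linear_form_expand:
  assumes "linear_form \<phi>" "v \<in> carrier V"
  shows "\<phi> v = (\<Sum>i\<le>d. coord i v * \<phi> (u i))"
proof -
  have "\<phi> v = \<phi> (\<Oplus>i\<in>{..d}. coord i v \<odot> u i)"
    using comb_coord[OF assms(2)] by (simp add: comb_def)
  also have "\<dots> = (\<Sum>i\<le>d. \<phi> (coord i v \<odot> u i))"
    by (rule linear_form_finsum[OF assms(1)]) auto
  also have "\<dots> = (\<Sum>i\<le>d. coord i v * \<phi> (u i))"
    using assms(1) by (simp add: linear_form_def)
  finally show ?thesis .
qed

lemma linear_form_eqI: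
  assumes "linear_form \<phi>" "linear_form \<psi>" "\<And>i. i \<le> d \<Longrightarrow> \<phi> (u i) = \<psi> (u i)" "v \<in> carrier V"
  shows "\<phi> v = \<psi> v"
  unfolding linear_form_expand[OF assms(1,4)] linear_form_expand[OF assms(2,4)]
  using assms(3) by simp

end

text \<open>Uniqueness of coordinates determines every entry, which makes the definite description
  well defined.\<close>

lemma (in based_space) transition_matrix_eqI:
  assumes "P \<in> carrier_mat (d + 1) (d + 1)"
    and "\<And>j. j \<le> d \<Longrightarrow> v j = comb (\<lambda>i. P $$ (i, j))"
  shows "transition_matrix V d u v = P"
  unfolding transition_matrix_def
proof (rule the_equality)
  show "P \<in> carrier_mat (d + 1) (d + 1) \<and> (\<forall>j\<le>d. v j = (\<Oplus>i\<in>{..d}. P $$ (i, j) \<odot> u i))"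
    using assms by (simp add: comb_def)
  fix Q assume Q: "Q \<in> carrier_mat (d + 1) (d + 1) \<and> (\<forall>j\<le>d. v j = (\<Oplus>i\<in>{..d}. Q $$ (i, j) \<odot> u i))"
  then have "comb (\<lambda>i. P $$ (i, j)) = comb (\<lambda>i. Q $$ (i, j))" if "j \<le> d" for j
    using that assms(2) by (simp add: comb_def)
  then have "P $$ (i, j) = Q $$ (i, j)" if "i \<le> d" "j \<le> d" for i j
    using that comb_inject[of "\<lambda>i. P $$ (i, j)" "\<lambda>i. Q $$ (i, j)" i] by blast
  then show "Q = P" using assms(1) Q by (intro eq_matI) auto
qed

lemma based_spaceI:
  assumes "indexed_basis V d u" shows "based_space V d u"
  using assms
  by (intro based_space.intro class_vectorspace.intro based_space_axioms.intro)
    (simp_all add: indexed_basis_def)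


section \<open>The algebra of linear maps\<close>

lemma End_algebra_simps:
  "mult (End_algebra V) = compose (carrier V)"
  "one (End_algebra V) = (\<lambda>v\<in>carrier V. v)"
  "zero (End_algebra V) = (\<lambda>v\<in>carrier V. \<zero>\<^bsub>V\<^esub>)"
  "add (End_algebra V) f g = (\<lambda>v\<in>carrier V. f v \<oplus>\<^bsub>V\<^esub> g v)"
  "smult (End_algebra V) c f = (\<lambda>v\<in>carrier V. c \<odot>\<^bsub>V\<^esub> f v)"
  by (simp_all add: End_algebra_def)

context class_vectorspace
begin

lemma End_iff:
  "f \<in> carrier (End_algebra V) \<longleftrightarrow>
     (\<forall>v\<in>carrier V. f v \<in> carrier V) \<and>
     (\<forall>v\<in>carrier V. \<forall>w\<in>carrier V. f (v \<oplus> w) = f v \<oplus> f w) \<and>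
     (\<forall>c. \<forall>v\<in>carrier V. f (c \<odot> v) = c \<odot> f v) \<and> f \<in> extensional (carrier V)"
  by (auto simp: End_algebra_def LinearCombinations.module_hom_def Pi_def class_ring_simps)

lemma End_closed: "f \<in> carrier (End_algebra V) \<Longrightarrow> v \<in> carrier V \<Longrightarrow> f v \<in> carrier V"
  by (simp add: End_iff)

lemma End_add:
  "f \<in> carrier (End_algebra V) \<Longrightarrow> v \<in> carrier V \<Longrightarrow> w \<in> carrier V \<Longrightarrow> f (v \<oplus> w) = f v \<oplus> f w"
  by (simp add: End_iff)

lemma End_smult:
  "f \<in> carrier (End_algebra V) \<Longrightarrow> v \<in> carrier V \<Longrightarrow> f (c \<odot> v) = c \<odot> f v"
  by (simp add: End_iff)

lemma End_eqI:
  assumes "f \<in> carrier (End_algebra V)" "g \<in> carrier (End_algebra V)"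
    "\<And>v. v \<in> carrier V \<Longrightarrow> f v = g v"
  shows "f = g"
  using assms by (intro extensionalityI[of _ "carrier V"]) (auto simp: End_iff)

lemma End_zero_apply: "f \<in> carrier (End_algebra V) \<Longrightarrow> f \<zero> = \<zero>"
  using smult_l_null by (metis End_iff M.zero_closed)

lemma End_ring_ops_closed [simp]:
  "\<one>\<^bsub>End_algebra V\<^esub> \<in> carrier (End_algebra V)"
  "\<zero>\<^bsub>End_algebra V\<^esub> \<in> carrier (End_algebra V)"
  "f \<in> carrier (End_algebra V) \<Longrightarrow> g \<in> carrier (End_algebra V) \<Longrightarrow>
     f \<otimes>\<^bsub>End_algebra V\<^esub> g \<in> carrier (End_algebra V)"
  "f \<in> carrier (End_algebra V) \<Longrightarrow> g \<in> carrier (End_algebra V) \<Longrightarrow>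
     f \<oplus>\<^bsub>End_algebra V\<^esub> g \<in> carrier (End_algebra V)"
  "f \<in> carrier (End_algebra V) \<Longrightarrow> c \<odot>\<^bsub>End_algebra V\<^esub> f \<in> carrier (End_algebra V)"
  by (auto simp: End_iff End_algebra_simps compose_def smult_r_distr M.a_ac smult_assoc1[symmetric]
      mult.commute)

lemma End_apply:
  assumes "v \<in> carrier V"
  shows "\<one>\<^bsub>End_algebra V\<^esub> v = v" "\<zero>\<^bsub>End_algebra V\<^esub> v = \<zero>"
    "(f \<otimes>\<^bsub>End_algebra V\<^esub> g) v = f (g v)"
    "(f \<oplus>\<^bsub>End_algebra V\<^esub> g) v = f v \<oplus> g v"
    "(c \<odot>\<^bsub>End_algebra V\<^esub> f) v = c \<odot> f v"
  using assms by (simp_all add: End_algebra_simps compose_def)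

lemma abelian_group_End: "abelian_group (End_algebra V)"
proof (rule abelian_groupI)
  fix f assume f: "f \<in> carrier (End_algebra V)"
  have "(- 1) \<odot>\<^bsub>End_algebra V\<^esub> f \<oplus>\<^bsub>End_algebra V\<^esub> f = \<zero>\<^bsub>End_algebra V\<^esub>"
    using f by (intro End_eqI)
      (auto simp: End_apply End_closed smult_l_minus M.l_neg)
  then show "\<exists>g\<in>carrier (End_algebra V). g \<oplus>\<^bsub>End_algebra V\<^esub> f = \<zero>\<^bsub>End_algebra V\<^esub>"
    using f by (intro bexI[of _ "(- 1) \<odot>\<^bsub>End_algebra V\<^esub> f"]) auto
qed (auto intro!: End_eqI simp: End_apply End_closed M.a_ac)

lemma module_End: "module class_ring (End_algebra V)"
proof (rule moduleI)
  show "cring (class_ring :: 'f ring)"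
    by (rule module.axioms(1)[OF vectorspace.axioms(1)[OF vectorspace_class_ring]])
qed (auto intro!: End_eqI abelian_group_End simp: class_ring_simps End_apply End_closed
      smult_l_distr smult_r_distr smult_assoc1)

lemma vectorspace_End: "vectorspace class_ring (End_algebra V)"
  using vectorspace_class_ring module_End by (simp add: vectorspace_def)

lemma ring_End: "ring (End_algebra V)"
proof (rule ringI)
  show "monoid (End_algebra V)"
    by (rule monoidI) (auto intro!: End_eqI simp: End_apply End_closed)
qed (auto intro!: End_eqI abelian_group_End simp: End_apply End_closed End_add)

lemma assoc_algebra_End: "assoc_algebra (End_algebra V)"
  unfolding assoc_algebra_def
  using ring_End module_End
  by (auto intro!: End_eqI simp: End_apply End_closed End_smult)

lemma End_finsum_apply:
  assumes "finite S" "\<And>i. i \<in> S \<Longrightarrow> F i \<in> carrier (End_algebra V)" "v \<in> carrier V"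
  shows "(\<Oplus>\<^bsub>End_algebra V\<^esub>i\<in>S. F i) v = (\<Oplus>i\<in>S. F i v)"
proof -
  interpret E: abelian_group "End_algebra V" by (rule abelian_group_End)
  show ?thesis
    using assms(1,2)
  proof (induction S)
    case empty
    then show ?case using assms(3) by (simp add: End_apply)
  next
    case (insert s S)
    then have F: "F \<in> S \<rightarrow> carrier (End_algebra V)" "F s \<in> carrier (End_algebra V)"
      "(\<lambda>i. F i v) \<in> S \<rightarrow> carrier V" "F s v \<in> carrier V"
      using assms(3) by (auto simp: End_closed)
    then show ?case using insert assms(3) by (simp add: End_apply)
  qed
qed

end

section \<open>Matrices of linear maps\<close>

context based_space
begin

text \<open>Following a linear map by a coordinate yields a functional, which reduces identities
  between maps to \<open>linear_form_eqI\<close> and \<open>linear_form_expand\<close>.\<close>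

lemma linear_form_coord_End:
  assumes "f \<in> carrier (End_algebra V)" "i \<le> d"
  shows "linear_form (\<lambda>v. coord i (f v))"
  using assms by (simp add: linear_form_def End_add End_smult End_closed coord_add coord_smult)

lemma End_eqI_basis:
  assumes "f \<in> carrier (End_algebra V)" "g \<in> carrier (End_algebra V)"
    "\<And>i. i \<le> d \<Longrightarrow> f (u i) = g (u i)"
  shows "f = g"
proof (rule End_eqI[OF assms(1,2)])
  fix v assume v: "v \<in> carrier V"
  show "f v = g v"
  proof (rule coord_eqI)
    fix i assume i: "i \<le> d"
    show "coord i (f v) = coord i (g v)"
      by (rule linear_form_eqI[OF linear_form_coord_End[OF assms(1) i]
            linear_form_coord_End[OF assms(2) i] _ v]) (simp add: assms(3))
  qed (use assms v in \<open>auto simp: End_closed\<close>)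
qed

definition mat_of :: "('v \<Rightarrow> 'v) \<Rightarrow> 'f mat" where
  "mat_of f = mat (d + 1) (d + 1) (\<lambda>(i, j). coord i (f (u j)))"

lemma mat_of_mult:
  assumes f: "f \<in> carrier (End_algebra V)" and g: "g \<in> carrier (End_algebra V)"
  shows "mat_of (f \<otimes>\<^bsub>End_algebra V\<^esub> g) = mat_of f * mat_of g"
proof (rule eq_matI)
  fix i j assume ij: "i < dim_row (mat_of f * mat_of g)" "j < dim_col (mat_of f * mat_of g)"
  then have i: "i \<le> d" and j: "j \<le> d" by (auto simp: mat_of_def)
  \<comment> \<open>Expanding the functional \<open>\<lambda>v. coord i (f v)\<close> at the vector
    \<open>g (u j)\<close> gives the matrix product up to the order of the factors.\<close>
  have "coord i (f (g (u j))) = (\<Sum>k\<le>d. coord k (g (u j)) * coord i (f (u k)))"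
    using g j by (intro linear_form_expand[OF linear_form_coord_End[OF f i]]) (auto simp: End_closed)
  also have "\<dots> = (\<Sum>k = 0..<d + 1. coord i (f (u k)) * coord k (g (u j)))"
    by (rule sum.cong) (auto simp: mult.commute)
  also have "\<dots> = (mat_of f * mat_of g) $$ (i, j)"
    using i j by (auto simp: mat_of_def scalar_prod_def intro!: sum.cong)
  finally show "mat_of (f \<otimes>\<^bsub>End_algebra V\<^esub> g) $$ (i, j) = (mat_of f * mat_of g) $$ (i, j)"
    using i j by (simp add: mat_of_def End_apply)
qed (auto simp: mat_of_def)

lemma bij_betw_mat_of: "bij_betw mat_of (carrier (End_algebra V)) (carrier_mat (d + 1) (d + 1))"
proof (rule bij_betw_imageI)
  show "inj_on mat_of (carrier (End_algebra V))"
  proof (rule inj_onI)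
    fix f g assume fg: "f \<in> carrier (End_algebra V)" "g \<in> carrier (End_algebra V)" "mat_of f = mat_of g"
    have "coord i (f (u j)) = coord i (g (u j))" if "i \<le> d" "j \<le> d" for i j
      using arg_cong[OF fg(3), of "\<lambda>M. M $$ (i, j)"] that by (simp add: mat_of_def)
    then show "f = g"
      using fg by (auto intro!: End_eqI_basis coord_eqI simp: End_closed)
  qed
  show "mat_of ` carrier (End_algebra V) = carrier_mat (d + 1) (d + 1)"
  proof (intro equalityI subsetI)
    fix M :: "'f mat" assume M: "M \<in> carrier_mat (d + 1) (d + 1)"
    \<comment> \<open>The preimage of \<open>M\<close> acts on coordinate vectors by multiplication
      with \<open>M\<close>.\<close>
    define f where "f = (\<lambda>v\<in>carrier V. comb (\<lambda>i. \<Sum>j\<le>d. M $$ (i, j) * coord j v))"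
    have add: "(\<Sum>j\<le>d. M $$ (i, j) * coord j (v \<oplus> w)) =
        (\<Sum>j\<le>d. M $$ (i, j) * coord j v) + (\<Sum>j\<le>d. M $$ (i, j) * coord j w)"
      if "v \<in> carrier V" "w \<in> carrier V" for i v w
      unfolding sum.distrib[symmetric] using that
      by (intro sum.cong) (auto simp: coord_add ring_distribs)
    have smult: "(\<Sum>j\<le>d. M $$ (i, j) * coord j (c \<odot> v)) = c * (\<Sum>j\<le>d. M $$ (i, j) * coord j v)"
      if "v \<in> carrier V" for i c v
      unfolding sum_distrib_left using that
      by (intro sum.cong) (auto simp: coord_smult)
    have f: "f \<in> carrier (End_algebra V)"
      by (auto simp: End_iff f_def comb_add comb_smult add smult)
    have "(\<Sum>j\<le>d. M $$ (i, j) * coord j (u k)) = M $$ (i, k)" if "k \<le> d" for i k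
    proof -
      have "(\<Sum>j\<le>d. M $$ (i, j) * coord j (u k)) = (\<Sum>j\<le>d. if j = k then M $$ (i, j) else 0)"
        using that by (intro sum.cong) (auto simp: coord_u)
      then show ?thesis using that by simp
    qed
    then have "mat_of f = M"
      using M by (intro eq_matI) (auto simp: mat_of_def f_def less_Suc_eq_le)
    then show "M \<in> mat_of ` carrier (End_algebra V)" using f by blast
  qed (auto simp: mat_of_def)
qed

lemma mat_of_algebra_iso: "mat_of \<in> algebra_iso (End_algebra V) (mat_algebra (d + 1))"
  unfolding algebra_iso_def
proof
  have "mat_of \<in> Ring.ring_hom (End_algebra V) (mat_algebra (d + 1))"
  proof (rule ring_hom_memI)
    fix f g assume "f \<in> carrier (End_algebra V)" "g \<in> carrier (End_algebra V)"
    then show "mat_of (f \<otimes>\<^bsub>End_algebra V\<^esub> g) = mat_of f \<otimes>\<^bsub>mat_algebra (d + 1)\<^esub> mat_of g"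
      by (simp add: mat_of_mult module_mat_simps)
  qed (auto simp: module_mat_simps mat_of_def End_apply End_closed coord_add coord_u intro!: eq_matI)
  then show "mat_of \<in> ring_iso (End_algebra V) (mat_algebra (d + 1))"
    using bij_betw_mat_of by (simp add: ring_iso_def module_mat_simps)
  show "mat_of \<in> LinearCombinations.module_hom class_ring (End_algebra V) (mat_algebra (d + 1))"
    by (auto simp: LinearCombinations.module_hom_def module_mat_simps mat_of_def End_apply End_closed coord_add coord_smult
        intro!: eq_matI)
qed

end


section \<open>Idempotents of rank one\<close>

text \<open>A nonzero entry lies in a nonzero column, and a nonzero column by itself is linearly
  independent.\<close>

lemma (in vec_space) rank_pos:
  assumes M: "M \<in> carrier_mat n nc" and rk: "r < n" "k < nc" "M $$ (r, k) \<noteq> 0"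
  shows "rank M > 0"
proof -
  have col: "col M k \<in> set (cols M)" "col M k \<in> carrier_vec n"
    using M rk by (auto simp: cols_def)
  have "col M k $ r \<noteq> 0\<^sub>v n $ r" using M rk by simp
  then have "col M k \<noteq> 0\<^sub>v n" by metis
  then have "lin_indpt {col M k}"
    using lindep_span[of "{col M k}"] span_empty col by auto
  then show ?thesis
    using rank_ge_card_indpt[OF M _ \<open>lin_indpt {col M k}\<close>] col by simp
qed

text \<open>
  Taking for \<open>N\<close> the elementary matrices gives \<open>M\<^sub>s\<^sub>j M\<^sub>r\<^sub>k = c\<^sub>j M\<^sub>s\<^sub>k\<close>, so that \<open>M\<close> is an outer product
  as soon as some \<open>M\<^sub>r\<^sub>k\<close> is nonzero.
\<close>

lemma mat_minimal_idempotent_rank: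
  fixes M :: "'f::field mat"
  assumes M: "M \<in> carrier_mat n n" "M \<noteq> 0\<^sub>m n n"
    and minimal: "\<And>N. N \<in> carrier_mat n n \<Longrightarrow> \<exists>c. M * N * M = c \<cdot>\<^sub>m M"
  shows "vec_space.rank n M = 1"
proof -
  interpret vec_space "TYPE('f)" n .
  obtain r k where rk: "r < n" "k < n" "M $$ (r, k) \<noteq> 0"
    using M by (metis eq_matI carrier_matD index_zero_mat)
  have entry: "(A * B) $$ (s, b) = (\<Sum>a = 0..<n. A $$ (s, a) * B $$ (a, b))"
    if "A \<in> carrier_mat n n" "B \<in> carrier_mat n n" "s < n" "b < n" for A B :: "'f mat" and s b
    using that by (simp add: scalar_prod_def)
  have "\<exists>c. \<forall>s<n. M $$ (s, j) * M $$ (r, k) = c * M $$ (s, k)" if j: "j < n" for j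
  proof -
    define N :: "'f mat" where "N = mat n n (\<lambda>(a, b). if a = j \<and> b = r then 1 else 0)"
    have N: "N \<in> carrier_mat n n" by (simp add: N_def)
    obtain c where c: "M * N * M = c \<cdot>\<^sub>m M" using minimal[OF N] by blast
    have MN: "(M * N) $$ (s, b) = (if b = r then M $$ (s, j) else 0)" if "s < n" "b < n" for s b
    proof -
      have "(M * N) $$ (s, b) = (\<Sum>a = 0..<n. M $$ (s, a) * N $$ (a, b))"
        using that M N by (intro entry) auto
      also have "\<dots> = (\<Sum>a = 0..<n. if a = j then (if b = r then M $$ (s, j) else 0) else 0)"
        using that by (intro sum.cong) (auto simp: N_def)
      finally show ?thesis using j by simp
    qed
    have "M $$ (s, j) * M $$ (r, k) = c * M $$ (s, k)" if s: "s < n" for s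
    proof -
      have "(M * N * M) $$ (s, k) = (\<Sum>b = 0..<n. (M * N) $$ (s, b) * M $$ (b, k))"
        using s rk M N by (intro entry) auto
      also have "\<dots> = (\<Sum>b = 0..<n. if b = r then M $$ (s, j) * M $$ (r, k) else 0)"
        using s by (intro sum.cong) (auto simp: MN simp del: index_mult_mat)
      finally have "(M * N * M) $$ (s, k) = M $$ (s, j) * M $$ (r, k)"
        using rk by simp
      then show ?thesis using c s rk M by simp
    qed
    then show ?thesis by blast
  qed
  then obtain c where c: "\<And>j s. j < n \<Longrightarrow> s < n \<Longrightarrow> M $$ (s, j) * M $$ (r, k) = c j * M $$ (s, k)"
    by metis
  have "rank M \<le> 1"
    using M rk c by (intro rank_le_1_product_entries[where f = "\<lambda>s. M $$ (s, k)"
          and g = "\<lambda>j. c j / M $$ (r, k)"]) (auto simp: field_simps)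
  moreover have "rank M > 0" using M rk by (intro rank_pos)
  ultimately show ?thesis by simp
qed

text \<open>
  The condition \<open>E A E = K E\<close> is invariant under isomorphism, so the arbitrary choice of
  isomorphism in \<open>alg_rank\<close> does no harm.
\<close>

lemma alg_rank_minimal_idempotent:
  assumes "ring A" and "algebra_iso A (mat_algebra n) \<noteq> {}"
    and E: "E \<in> carrier A" "E \<noteq> \<zero>\<^bsub>A\<^esub>"
    and minimal: "\<And>a. a \<in> carrier A \<Longrightarrow> \<exists>c. E \<otimes>\<^bsub>A\<^esub> a \<otimes>\<^bsub>A\<^esub> E = c \<odot>\<^bsub>A\<^esub> E"
  shows "alg_rank n A E = 1"
proof -
  interpret ring A by fact
  define h where "h = (SOME h. h \<in> algebra_iso A (mat_algebra n))"
  have "h \<in> algebra_iso A (mat_algebra n)"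
    unfolding h_def using assms(2) by (simp add: some_in_eq)
  then have hom: "h \<in> Ring.ring_hom A (mat_algebra n)"
    and bij: "bij_betw h (carrier A) (carrier_mat n n)"
    and smult: "\<And>c a. a \<in> carrier A \<Longrightarrow> h (c \<odot>\<^bsub>A\<^esub> a) = c \<cdot>\<^sub>m h a"
    by (auto simp: algebra_iso_def ring_iso_def LinearCombinations.module_hom_def
        module_mat_simps class_ring_simps)
  have hE: "h E \<in> carrier_mat n n" using bij E by (auto simp: bij_betw_def)
  have "h E \<noteq> 0\<^sub>m n n"
  proof
    assume "h E = 0\<^sub>m n n"
    \<comment> \<open>Additivity alone suffices: if \<open>h E\<close> vanishes, then
      \<open>E\<close> and its double have the same image, and injectivity forces \<open>E\<close>
      to be zero.\<close>
    then have "h (E \<oplus>\<^bsub>A\<^esub> E) = h E"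
      using ring_hom_add[OF hom E(1) E(1)] by (simp add: module_mat_simps)
    then have "E \<oplus>\<^bsub>A\<^esub> E = E"
      using bij E by (auto simp: bij_betw_def inj_on_def)
    then show False using E by (metis add.r_cancel_one)
  qed
  moreover have "\<exists>c. h E * N * h E = c \<cdot>\<^sub>m h E" if N: "N \<in> carrier_mat n n" for N
  proof -
    obtain a where a: "a \<in> carrier A" "N = h a"
      using bij N by (auto simp: bij_betw_def)
    obtain c where "E \<otimes>\<^bsub>A\<^esub> a \<otimes>\<^bsub>A\<^esub> E = c \<odot>\<^bsub>A\<^esub> E" using minimal[OF a(1)] by blast
    then have "h (E \<otimes>\<^bsub>A\<^esub> a \<otimes>\<^bsub>A\<^esub> E) = c \<cdot>\<^sub>m h E" using smult E by simp
    then show ?thesis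
      using ring_hom_mult[OF hom] a E by (auto simp: module_mat_simps)
  qed
  ultimately show ?thesis
    unfolding alg_rank_def h_def[symmetric] by (rule mat_minimal_idempotent_rank[OF hE])
qed

section \<open>The idempotents attached to a basis\<close>

context based_space
begin

lemma basis_idempotent_eq:
  assumes i: "i \<le> d"
  shows "basis_idempotent V d u i = (\<lambda>v\<in>carrier V. coord i v \<odot> u i)"
proof -
  let ?E = "\<lambda>v\<in>carrier V. coord i v \<odot> u i"
  have E: "?E \<in> carrier (End_algebra V)"
    using i by (auto simp: End_iff coord_add coord_smult smult_l_distr smult_assoc1)
  show ?thesis
    unfolding basis_idempotent_def
  proof (rule the_equality)
    show "?E \<in> carrier (End_algebra V) \<and> (\<forall>j\<le>d. ?E (u j) = (if i = j then u j else \<zero>))"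
      using i E by (auto simp: coord_u)
    show "f = ?E" if "f \<in> carrier (End_algebra V) \<and> (\<forall>j\<le>d. f (u j) = (if i = j then u j else \<zero>))" for f
      using that i E by (intro End_eqI_basis) (auto simp: coord_u)
  qed
qed

lemma basis_idempotent_apply:
  "i \<le> d \<Longrightarrow> v \<in> carrier V \<Longrightarrow> basis_idempotent V d u i v = coord i v \<odot> u i"
  by (simp add: basis_idempotent_eq)

lemma basis_idempotent_closed [simp]:
  "i \<le> d \<Longrightarrow> basis_idempotent V d u i \<in> carrier (End_algebra V)"
  by (auto simp: End_iff basis_idempotent_eq coord_add coord_smult smult_l_distr smult_assoc1)

lemma basis_idempotent_mult:
  assumes "i \<le> d" "j \<le> d"
  shows "basis_idempotent V d u i \<otimes>\<^bsub>End_algebra V\<^esub> basis_idempotent V d u j =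
    (if i = j then basis_idempotent V d u i else \<zero>\<^bsub>End_algebra V\<^esub>)"
  using assms
  by (intro End_eqI) (auto simp: End_apply basis_idempotent_apply coord_smult coord_u)

lemma orthogonal_rank1_basis_idempotents:
  "orthogonal_rank1_idempotents (End_algebra V) d (basis_idempotent V d u)"
proof -
  have "alg_rank (d + 1) (End_algebra V) (basis_idempotent V d u i) = 1" if i: "i \<le> d" for i
  proof (rule alg_rank_minimal_idempotent)
    let ?E = "basis_idempotent V d u i"
    show "ring (End_algebra V)" by (rule ring_End)
    show "algebra_iso (End_algebra V) (mat_algebra (d + 1)) \<noteq> {}"
      using mat_of_algebra_iso by blast
    show "?E \<in> carrier (End_algebra V)" using i by simp
    have "?E (u i) \<noteq> \<zero>\<^bsub>End_algebra V\<^esub> (u i)"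
      using i by (simp add: basis_idempotent_apply End_apply coord_u u_nonzero)
    then show "?E \<noteq> \<zero>\<^bsub>End_algebra V\<^esub>" by metis
    \<comment> \<open>The scalar is the diagonal matrix entry of \<open>f\<close> at
      \<open>u i\<close>: a vector is first projected to a multiple of \<open>u i\<close>, and only
      the \<open>u i\<close>-coordinate of \<open>f (u i)\<close> survives the second
      projection.\<close>
    show "\<exists>c. ?E \<otimes>\<^bsub>End_algebra V\<^esub> f \<otimes>\<^bsub>End_algebra V\<^esub> ?E = c \<odot>\<^bsub>End_algebra V\<^esub> ?E"
      if f: "f \<in> carrier (End_algebra V)" for f
      using i f
      by (intro exI[of _ "coord i (f (u i))"] End_eqI)
        (auto simp: End_apply End_closed End_smult basis_idempotent_apply coord_smult
          smult_assoc1[symmetric] mult.commute)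
  qed
  then show ?thesis
    by (simp add: orthogonal_rank1_idempotents_def basis_idempotent_mult)
qed

end


section \<open>Adjoints\<close>

text \<open>Linearity is assumed in the second argument and passes to the first by symmetry. Nonzero
  norms on an orthogonal basis make the form nondegenerate.\<close>

locale orthogonal_form = based_space V d u
  for V :: "('f::field, 'v, 'm) module_scheme" (structure) and d u +
  fixes B :: "'v \<Rightarrow> 'v \<Rightarrow> 'f"
  assumes form_linear: "y \<in> carrier V \<Longrightarrow> linear_form (B y)"
    and form_commute: "y \<in> carrier V \<Longrightarrow> z \<in> carrier V \<Longrightarrow> B y z = B z y"
    and form_orthogonal: "i \<le> d \<Longrightarrow> j \<le> d \<Longrightarrow> i \<noteq> j \<Longrightarrow> B (u i) (u j) = 0"
    and form_norm_nonzero: "i \<le> d \<Longrightarrow> B (u i) (u i) \<noteq> 0"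
begin

lemma form_basis:
  assumes i: "i \<le> d" and v: "v \<in> carrier V"
  shows "B (u i) v = B (u i) (u i) * coord i v"
proof -
  have "B (u i) v = (\<Sum>j\<le>d. coord j v * B (u i) (u j))"
    using i v by (intro linear_form_expand form_linear) auto
  also have "\<dots> = (\<Sum>j\<le>d. if j = i then B (u i) (u i) * coord i v else 0)"
    using i by (intro sum.cong) (auto simp: form_orthogonal)
  finally show ?thesis using i by simp
qed

lemma form_nondegenerate:
  assumes "v \<in> carrier V" "w \<in> carrier V" "\<And>y. y \<in> carrier V \<Longrightarrow> B y v = B y w"
  shows "v = w"
proof (rule coord_eqI[OF assms(1,2)])
  fix i assume i: "i \<le> d"
  show "coord i v = coord i w"
    using assms(3)[OF u_closed[OF i]] form_basis[OF i] form_norm_nonzero[OF i] assms(1,2) by simp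
qed

text \<open>The coefficients are forced: the \<open>i\<close>-th coordinate of the adjoint's value
  at \<open>z\<close>, multiplied by the norm of \<open>u i\<close>, must be
  \<open>B (f (u i)) z\<close> by \<open>form_basis\<close>.\<close>

definition adjoint :: "('v \<Rightarrow> 'v) \<Rightarrow> 'v \<Rightarrow> 'v" where
  "adjoint f = (\<lambda>z\<in>carrier V. comb (\<lambda>i. B (f (u i)) z / B (u i) (u i)))"

lemma form_add_right:
  "y \<in> carrier V \<Longrightarrow> v \<in> carrier V \<Longrightarrow> w \<in> carrier V \<Longrightarrow> B y (v \<oplus> w) = B y v + B y w"
  using form_linear by (simp add: linear_form_def)

lemma form_smult_right:
  "y \<in> carrier V \<Longrightarrow> v \<in> carrier V \<Longrightarrow> B y (c \<odot> v) = c * B y v"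
  using form_linear by (simp add: linear_form_def)

lemma form_add_left:
  "y \<in> carrier V \<Longrightarrow> v \<in> carrier V \<Longrightarrow> w \<in> carrier V \<Longrightarrow> B (v \<oplus> w) y = B v y + B w y"
  using form_commute[of _ y] by (simp add: form_add_right)

lemma form_smult_left:
  "y \<in> carrier V \<Longrightarrow> v \<in> carrier V \<Longrightarrow> B (c \<odot> v) y = c * B v y"
  using form_commute[of _ y] by (simp add: form_smult_right)

lemma adjoint_closed [simp]:
  assumes f: "f \<in> carrier (End_algebra V)"
  shows "adjoint f \<in> carrier (End_algebra V)"
proof -
  \<comment> \<open>Membership of \<open>f (u i)\<close> in the carrier is available only for
    \<open>i \<le> d\<close>, so coefficient functions are compared only there.\<close>
  have comb_cong: "comb a = comb b" if "\<And>i. i \<le> d \<Longrightarrow> a i = b i" for a b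
    using that by (intro coord_eqI) auto
  have fu: "f (u i) \<in> carrier V" if "i \<le> d" for i using f that by (simp add: End_closed)
  show ?thesis
    by (auto simp: End_iff adjoint_def comb_add comb_smult form_add_right form_smult_right fu add_divide_distrib
        intro!: comb_cong)
qed

text \<open>Both sides are linear in \<open>y\<close>, and on the basis the equation is how the
  coefficients of the adjoint were chosen.\<close>

lemma form_adjoint:
  assumes f: "f \<in> carrier (End_algebra V)" and y: "y \<in> carrier V" and z: "z \<in> carrier V"
  shows "B y (adjoint f z) = B (f y) z"
proof (rule linear_form_eqI[OF _ _ _ y])
  have z': "adjoint f z \<in> carrier V" using f z by (auto intro: End_closed)
  show "linear_form (\<lambda>y. B y (adjoint f z))"
    using z' by (simp add: linear_form_def form_add_left form_smult_left)
  show "linear_form (\<lambda>y. B (f y) z)"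
    using f z by (simp add: linear_form_def form_add_left form_smult_left End_closed End_add End_smult)
  show "B (u i) (adjoint f z) = B (f (u i)) z" if "i \<le> d" for i
    using that z z' form_norm_nonzero[of i] by (subst form_basis) (auto simp: adjoint_def)
qed

text \<open>Nondegeneracy makes adjoints unique. All algebraic laws for \<open>adjoint\<close>, and
  its fixed points, are derived through this criterion.\<close>

lemma adjoint_eqI:
  assumes "f \<in> carrier (End_algebra V)" "g \<in> carrier (End_algebra V)"
    "\<And>y z. y \<in> carrier V \<Longrightarrow> z \<in> carrier V \<Longrightarrow> B (f y) z = B y (g z)"
  shows "adjoint f = g"
  using assms by (intro End_eqI form_nondegenerate) (auto simp: form_adjoint intro: End_closed)

lemma adjoint_adjoint:
  assumes f: "f \<in> carrier (End_algebra V)"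
  shows "adjoint (adjoint f) = f"
proof (rule adjoint_eqI)
  fix y z assume y: "y \<in> carrier V" and z: "z \<in> carrier V"
  then have "B (adjoint f y) z = B z (adjoint f y)"
    using f by (intro form_commute) (auto intro: End_closed)
  also have "\<dots> = B (f z) y" using f y z by (simp add: form_adjoint)
  also have "\<dots> = B y (f z)" using f y z by (intro form_commute) (auto intro: End_closed)
  finally show "B (adjoint f y) z = B y (f z)" .
qed (use f in auto)

text \<open>Moving factors across the form one at a time reverses products. Bijectivity holds
  because \<open>adjoint\<close> is an involution.\<close>

lemma antiautomorphism_adjoint: "antiautomorphism (End_algebra V) adjoint"
proof -
  have "adjoint (f \<oplus>\<^bsub>End_algebra V\<^esub> g) = adjoint f \<oplus>\<^bsub>End_algebra V\<^esub> adjoint g"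
    if "f \<in> carrier (End_algebra V)" "g \<in> carrier (End_algebra V)" for f g
    using that by (intro adjoint_eqI)
      (auto simp: End_apply End_closed form_add_left form_add_right form_adjoint)
  moreover have "adjoint (c \<odot>\<^bsub>End_algebra V\<^esub> f) = c \<odot>\<^bsub>End_algebra V\<^esub> adjoint f"
    if "f \<in> carrier (End_algebra V)" for c f
    using that by (intro adjoint_eqI)
      (auto simp: End_apply End_closed form_smult_left form_smult_right form_adjoint)
  moreover have "adjoint (f \<otimes>\<^bsub>End_algebra V\<^esub> g) = adjoint g \<otimes>\<^bsub>End_algebra V\<^esub> adjoint f"
    if "f \<in> carrier (End_algebra V)" "g \<in> carrier (End_algebra V)" for f g
    using that by (intro adjoint_eqI) (auto simp: End_apply End_closed form_adjoint)
  moreover have "bij_betw adjoint (carrier (End_algebra V)) (carrier (End_algebra V))"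
    by (rule bij_betw_byWitness[where f' = adjoint]) (auto simp: adjoint_adjoint)
  ultimately show ?thesis
    by (auto simp: antiautomorphism_def LinearCombinations.module_hom_def)
qed

end


section \<open>Character systems\<close>

locale character_system_space =
  fixes C :: "('f::field, 'c, 'm) module_scheme" (structure) and d :: nat and x e :: "nat \<Rightarrow> 'c"
  assumes character_system: "character_system C d x e"
begin

lemma algebra_C: "algebra class_ring C"
  using character_system by (simp add: character_system_def character_algebra_def)

sublocale cring C
  using algebra_C by (rule algebra.M_cring)

text \<open>Two coordinate systems on the same space: \<open>X.coord\<close> belongs to
  \<open>x\<close>, \<open>Y.coord\<close> to \<open>e\<close>. The functional t is
  \<open>X.coord 0\<close>, and \<open>Y.coord 0\<close> turns out to be the character.\<close>

sublocale X: based_space C d x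
  using character_system by (intro based_spaceI) (simp add: character_system_def character_algebra_def)

sublocale Y: based_space C d e
  using character_system by (intro based_spaceI) (simp add: character_system_def primitive_idempotents_def)

lemma smult_mult_left:
  "y \<in> carrier C \<Longrightarrow> z \<in> carrier C \<Longrightarrow> (c \<odot> y) \<otimes> z = c \<odot> (y \<otimes> z)"
  using algebra.smult_assoc2[OF algebra_C, of c y z] by (simp add: class_ring_simps)

lemma smult_mult_right:
  "y \<in> carrier C \<Longrightarrow> z \<in> carrier C \<Longrightarrow> y \<otimes> (c \<odot> z) = c \<odot> (y \<otimes> z)"
  using smult_mult_left[of z y c] m_comm[of y] by simp

lemma x_zero: "x 0 = \<one>"
  using character_system by (simp add: character_system_def character_algebra_def)

lemma e_mult: "i \<le> d \<Longrightarrow> j \<le> d \<Longrightarrow> e i \<otimes> e j = (if i = j then e i else \<zero>)"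
  using character_system by (simp add: character_system_def primitive_idempotents_def)

section \<open>The regular representation, the character and the bilinear form\<close>

definition mult_map :: "'c \<Rightarrow> 'c \<Rightarrow> 'c" where
  "mult_map y = (\<lambda>z\<in>carrier C. y \<otimes> z)"

lemma mult_map_apply: "z \<in> carrier C \<Longrightarrow> mult_map y z = y \<otimes> z"
  by (simp add: mult_map_def)

lemma mult_map_closed [simp]: "y \<in> carrier C \<Longrightarrow> mult_map y \<in> carrier (End_algebra C)"
  by (auto simp: X.End_iff mult_map_def r_distr smult_mult_right)

text \<open>By orthogonality of the idempotents, both maps fix \<open>e i\<close> and kill every
  other \<open>e j\<close>.\<close>

lemma basis_idempotent_e:
  assumes i: "i \<le> d" shows "basis_idempotent C d e i = mult_map (e i)"
  using i by (intro Y.End_eqI_basis) (auto simp: Y.basis_idempotent_apply Y.coord_u e_mult mult_map_apply)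

lemma e_mult_eq:
  assumes "i \<le> d" "y \<in> carrier C" shows "e i \<otimes> y = Y.coord i y \<odot> e i"
  using fun_cong[OF basis_idempotent_e[OF assms(1)], of y] assms
  by (simp add: mult_map_apply Y.basis_idempotent_apply)

text \<open>Structure constants are eliminated here: uniqueness of coordinates makes
  \<open>p 0 i j\<close> the \<open>x 0\<close>-coordinate of \<open>x i \<otimes> x j\<close>, and
  \<open>k i\<close> is the value of the character at \<open>x i\<close>.\<close>

lemma ex_character:
  "\<exists>\<phi>. \<phi> \<in> Ring.ring_hom C class_ring \<and> X.linear_form \<phi> \<and> \<phi> (e 0) \<noteq> 0 \<and>
     (\<forall>i\<le>d. \<phi> (x i) \<noteq> 0) \<and>
     (\<forall>i\<le>d. \<forall>j\<le>d. X.coord 0 (x i \<otimes> x j) = (if i = j then \<phi> (x i) else 0))"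
proof -
  obtain \<phi> where hom: "character_hom C d x \<phi>" and e0: "\<phi> (e 0) \<noteq> 0"
    using character_system by (auto simp: character_system_def)
  obtain p k where p: "\<forall>i\<le>d. \<forall>j\<le>d. x i \<otimes> x j = (\<Oplus>h\<in>{..d}. p h i j \<odot> x h)"
    and k: "\<forall>i\<le>d. k i \<noteq> 0" and pk: "\<forall>i\<le>d. \<forall>j\<le>d. p 0 i j = (if i = j then k i else 0)"
    and \<phi>: "\<phi> \<in> Ring.ring_hom C class_ring" "\<forall>c. \<forall>y\<in>carrier C. \<phi> (c \<odot> y) = c * \<phi> y"
    and \<phi>x: "\<forall>i\<le>d. \<phi> (x i) = k i"
    using hom unfolding character_hom_def by blast
  have "X.linear_form \<phi>"
    using \<phi> ring_hom_add[OF \<phi>(1)] by (simp add: X.linear_form_def class_ring_simps)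
  moreover have "X.coord 0 (x i \<otimes> x j) = (if i = j then \<phi> (x i) else 0)" if "i \<le> d" "j \<le> d" for i j
    using that p pk \<phi>x X.coord_comb[of 0 "\<lambda>h. p h i j"] by (simp add: X.comb_def)
  ultimately show ?thesis using \<phi> k \<phi>x e0 by (intro exI[of _ \<phi>]) auto
qed

text \<open>The character \<phi> is the \<open>e 0\<close>-coordinate: cancelling the nonzero
  \<open>\<phi> (e 0)\<close> in
  \<open>\<phi> (e 0) * \<phi> (e j) = \<phi> (e 0 \<otimes> e j)\<close> gives the value 1 at
  \<open>e 0\<close> and 0 at every other \<open>e j\<close>.\<close>

lemma coord_e_zero_x:
  assumes "i \<le> d"
  shows "Y.coord 0 (x i) \<noteq> 0" "X.coord 0 (x i \<otimes> x i) = Y.coord 0 (x i)"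
    "\<And>j. j \<le> d \<Longrightarrow> i \<noteq> j \<Longrightarrow> X.coord 0 (x i \<otimes> x j) = 0"
proof -
  obtain \<phi> where hom: "\<phi> \<in> Ring.ring_hom C class_ring" and lin: "X.linear_form \<phi>"
    and e0: "\<phi> (e 0) \<noteq> 0" and nz: "\<forall>i\<le>d. \<phi> (x i) \<noteq> 0"
    and xx: "\<forall>i\<le>d. \<forall>j\<le>d. X.coord 0 (x i \<otimes> x j) = (if i = j then \<phi> (x i) else 0)"
    using ex_character by blast
  have mult: "\<phi> (e 0) * \<phi> (e j) = \<phi> (e 0 \<otimes> e j)" if "j \<le> d" for j
    using that ring_hom_mult[OF hom, of "e 0" "e j"] by (simp add: class_ring_simps)
  have zero: "\<phi> \<zero> = 0"
    using lin zero_closed X.smult_l_null unfolding X.linear_form_def by (metis mult_zero_left)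
  have \<phi>e: "\<phi> (e j) = Y.coord 0 (e j)" if "j \<le> d" for j
    using mult[OF that] that e0 zero by (auto simp: e_mult Y.coord_u)
  have "\<phi> y = Y.coord 0 y" if "y \<in> carrier C" for y
    by (rule Y.linear_form_eqI[OF lin Y.linear_form_coord \<phi>e that]) auto
  then have "\<phi> (x i) = Y.coord 0 (x i)" using assms by simp
  then show "Y.coord 0 (x i) \<noteq> 0" "X.coord 0 (x i \<otimes> x i) = Y.coord 0 (x i)"
    "\<And>j. j \<le> d \<Longrightarrow> i \<noteq> j \<Longrightarrow> X.coord 0 (x i \<otimes> x j) = 0"
    using nz xx assms by auto
qed

text \<open>The form B(y, z) = t(yz). Symmetry is commutativity of \<open>C\<close>, and the norm of
  \<open>x i\<close> is \<open>Y.coord 0 (x i)\<close>, the scalar k_i.\<close>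

sublocale T: orthogonal_form C d x "\<lambda>y z. X.coord 0 (y \<otimes> z)"
proof
  show "X.linear_form (\<lambda>z. X.coord 0 (y \<otimes> z))" if "y \<in> carrier C" for y
    using that by (simp add: X.linear_form_def r_distr smult_mult_right X.coord_add X.coord_smult)
qed (auto simp: coord_e_zero_x m_comm)

lemma basis_idempotent_e_apply:
  "i \<le> d \<Longrightarrow> y \<in> carrier C \<Longrightarrow> basis_idempotent C d e i y = e i \<otimes> y"
  by (simp add: basis_idempotent_e mult_map_apply)

text \<open>Every product \<open>y \<otimes> e i\<close> is a multiple of \<open>e i\<close>. If t
  vanished at \<open>e i\<close>, then \<open>e i\<close> would be orthogonal to everything, hence
  zero.\<close>

lemma coord_x_zero_e:
  assumes i: "i \<le> d" shows "X.coord 0 (e i) \<noteq> 0"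
proof
  assume zero: "X.coord 0 (e i) = 0"
  have "e i = \<zero>"
  proof (rule T.form_nondegenerate)
    fix y assume y: "y \<in> carrier C"
    have "y \<otimes> e i = Y.coord i y \<odot> e i"
      using i y by (simp add: m_comm[of y] e_mult_eq)
    then show "X.coord 0 (y \<otimes> e i) = X.coord 0 (y \<otimes> \<zero>)"
      using i y zero by (simp add: X.coord_smult X.coord_zero)
  qed (use i in auto)
  then show False using Y.u_nonzero[OF i] by simp
qed

text \<open>Computing B(x_i, e_0) twice gives k_i times the \<open>i\<close>-th coordinate of
  \<open>e 0\<close>, and k_i m_0 because \<open>x i \<otimes> e 0\<close> is k_i times
  \<open>e 0\<close>. Thus \<open>e 0\<close> is m_0 times the sum of all
  \<open>x i\<close>.\<close>

lemma coord_x_e_zero: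
  assumes i: "i \<le> d" shows "X.coord i (e 0) = X.coord 0 (e 0)"
proof -
  have "x i \<otimes> e 0 = Y.coord 0 (x i) \<odot> e 0"
    using i by (simp add: m_comm[of "x i"] e_mult_eq)
  then have "Y.coord 0 (x i) * X.coord i (e 0) = Y.coord 0 (x i) * X.coord 0 (e 0)"
    using i T.form_basis[OF i, of "e 0"] by (simp add: coord_e_zero_x X.coord_smult)
  then show ?thesis using coord_e_zero_x(1)[OF i] by simp
qed

text \<open>Multiplication by \<open>e i\<close> is self-adjoint by associativity and commutativity.
  Projection to \<open>x i\<close> is self-adjoint because moving it to either side of B(y, z)
  leaves k_i times the product of the \<open>i\<close>-th coordinates of \<open>y\<close> and
  \<open>z\<close>.\<close>

lemma adjoint_basis_idempotents:
  assumes i: "i \<le> d"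
  shows "T.adjoint (basis_idempotent C d e i) = basis_idempotent C d e i"
    and "T.adjoint (basis_idempotent C d x i) = basis_idempotent C d x i"
proof -
  show "T.adjoint (basis_idempotent C d e i) = basis_idempotent C d e i"
    using i by (intro T.adjoint_eqI) (auto simp: basis_idempotent_e_apply m_assoc m_lcomm)
  show "T.adjoint (basis_idempotent C d x i) = basis_idempotent C d x i"
  proof (rule T.adjoint_eqI)
    fix y z assume yz: "y \<in> carrier C" "z \<in> carrier C"
    have "X.coord 0 (y \<otimes> x i) = X.coord 0 (x i \<otimes> y)" using i yz by (simp add: m_comm)
    then show "X.coord 0 (basis_idempotent C d x i y \<otimes> z) = X.coord 0 (y \<otimes> basis_idempotent C d x i z)"
      using i yz T.form_basis[OF i yz(1)] T.form_basis[OF i yz(2)]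
      by (simp add: X.basis_idempotent_apply smult_mult_left smult_mult_right X.coord_smult)
  qed (use i in auto)
qed

section \<open>The symmetric idempotent system\<close>

lemma symmetric_idempotent_system_End:
  "symmetric_idempotent_system (End_algebra C) d (basis_idempotent C d e) (basis_idempotent C d x)"
proof -
  let ?A = "End_algebra C" and ?E = "basis_idempotent C d e" and ?Es = "basis_idempotent C d x"
  have "?E 0 \<otimes>\<^bsub>?A\<^esub> ?Es i \<otimes>\<^bsub>?A\<^esub> ?E 0 \<noteq> \<zero>\<^bsub>?A\<^esub>" if i: "i \<le> d" for i
  proof
    assume "?E 0 \<otimes>\<^bsub>?A\<^esub> ?Es i \<otimes>\<^bsub>?A\<^esub> ?E 0 = \<zero>\<^bsub>?A\<^esub>"
    then have "(?E 0 \<otimes>\<^bsub>?A\<^esub> ?Es i \<otimes>\<^bsub>?A\<^esub> ?E 0) (e 0) = \<zero>\<^bsub>?A\<^esub> (e 0)" by simp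
    \<comment> \<open>\<open>?Es i\<close> sends \<open>e 0\<close> to m_0 times \<open>x i\<close>,
      whose \<open>e 0\<close>-coordinate is m_0 k_i.\<close>
    then have "(X.coord 0 (e 0) * Y.coord 0 (x i)) \<odot> e 0 = \<zero>"
      using i by (simp add: X.End_apply Y.basis_idempotent_apply X.basis_idempotent_apply Y.coord_u
          Y.coord_smult coord_x_e_zero[OF i])
    then have "Y.coord 0 ((X.coord 0 (e 0) * Y.coord 0 (x i)) \<odot> e 0) = Y.coord 0 \<zero>" by simp
    then show False
      using i coord_x_zero_e[of 0] coord_e_zero_x(1)[OF i] by (simp add: Y.coord_smult Y.coord_u Y.coord_zero)
  qed
  moreover have "?Es 0 \<otimes>\<^bsub>?A\<^esub> ?E i \<otimes>\<^bsub>?A\<^esub> ?Es 0 \<noteq> \<zero>\<^bsub>?A\<^esub>" if i: "i \<le> d" for i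
  proof
    assume "?Es 0 \<otimes>\<^bsub>?A\<^esub> ?E i \<otimes>\<^bsub>?A\<^esub> ?Es 0 = \<zero>\<^bsub>?A\<^esub>"
    then have "(?Es 0 \<otimes>\<^bsub>?A\<^esub> ?E i \<otimes>\<^bsub>?A\<^esub> ?Es 0) (x 0) = \<zero>\<^bsub>?A\<^esub> (x 0)" by simp
    \<comment> \<open>Since \<open>x 0\<close> is the unit, \<open>?E i\<close> sends it to
      \<open>e i\<close>, and \<open>?Es 0\<close> keeps the \<open>x 0\<close>-coordinate
      m_i.\<close>
    then have "X.coord 0 (e i) \<odot> x 0 = \<zero>"
      using i by (simp add: X.End_apply basis_idempotent_e_apply X.basis_idempotent_apply X.coord_u)
        (simp add: x_zero)
    then have "X.coord 0 (X.coord 0 (e i) \<odot> x 0) = X.coord 0 \<zero>" by simp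
    then show False
      using coord_x_zero_e[OF i] by (simp add: X.coord_smult X.coord_u X.coord_zero)
  qed
  moreover have "algebra_iso ?A (mat_algebra (d + 1)) \<noteq> {}"
    using X.mat_of_algebra_iso by blast
  ultimately have "idempotent_system ?A d ?E ?Es"
    unfolding idempotent_system_def
    using X.assoc_algebra_End X.orthogonal_rank1_basis_idempotents Y.orthogonal_rank1_basis_idempotents
    by blast
  then show ?thesis
    unfolding symmetric_idempotent_system_def
    using T.antiautomorphism_adjoint adjoint_basis_idempotents by blast
qed

section \<open>The elements A_i and the first eigenmatrix\<close>

lemma mult_map_expand:
  assumes y: "y \<in> carrier C"
  shows "mult_map y = (\<Oplus>\<^bsub>End_algebra C\<^esub>i\<in>{..d}. Y.coord i y \<odot>\<^bsub>End_algebra C\<^esub> basis_idempotent C d e i)"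
proof -
  interpret A: class_vectorspace "End_algebra C"
    using X.vectorspace_End by (rule class_vectorspace.intro)
  show ?thesis
  proof (rule X.End_eqI)
    fix z assume z: "z \<in> carrier C"
    have "y \<otimes> z = (\<Oplus>i\<in>{..d}. Y.coord i y \<odot> e i) \<otimes> z"
      using Y.comb_coord[OF y] by (simp add: Y.comb_def)
    also have "\<dots> = (\<Oplus>i\<in>{..d}. (Y.coord i y \<odot> e i) \<otimes> z)"
      using z by (intro finsum_ldistr) auto
    also have "\<dots> = (\<Oplus>i\<in>{..d}. (Y.coord i y \<odot>\<^bsub>End_algebra C\<^esub> basis_idempotent C d e i) z)"
      using z by (intro finsum_cong') (auto simp: X.End_apply basis_idempotent_e_apply smult_mult_left)
    also have "\<dots> = (\<Oplus>\<^bsub>End_algebra C\<^esub>i\<in>{..d}. Y.coord i y \<odot>\<^bsub>End_algebra C\<^esub> basis_idempotent C d e i) z"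
      using z by (intro X.End_finsum_apply[symmetric]) auto
    finally show "mult_map y z = \<dots>" using z by (simp add: mult_map_apply)
  qed (use y in \<open>auto intro!: A.M.finsum_closed\<close>)
qed

text \<open>The multiplication maps form a submodule containing all the idempotents, and evaluation
  at the unit recovers the multiplier.\<close>

lemma span_basis_idempotents:
  assumes a: "a \<in> LinearCombinations.module.span class_ring (End_algebra C) (basis_idempotent C d e ` {..d})"
  shows "a = mult_map (a \<one>)" "a \<in> carrier (End_algebra C)"
proof -
  interpret A: class_vectorspace "End_algebra C"
    using X.vectorspace_End by (rule class_vectorspace.intro)
  let ?H = "mult_map ` carrier C"
  have "submodule class_ring ?H (End_algebra C)"
  proof (rule submodule.intro)
    show "a \<oplus>\<^bsub>End_algebra C\<^esub> b \<in> ?H" if "a \<in> ?H" "b \<in> ?H" for a b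
    proof -
      obtain y where y: "a = mult_map y" "y \<in> carrier C" using \<open>a \<in> ?H\<close> by (rule imageE)
      obtain z where z: "b = mult_map z" "z \<in> carrier C" using \<open>b \<in> ?H\<close> by (rule imageE)
      from y z have "a \<oplus>\<^bsub>End_algebra C\<^esub> b = mult_map (y \<oplus> z)"
        by (intro X.End_eqI) (auto simp: X.End_apply mult_map_apply l_distr)
      then show ?thesis using y z by simp
    qed
    have "\<zero>\<^bsub>End_algebra C\<^esub> = mult_map \<zero>"
      by (intro X.End_eqI) (auto simp: X.End_apply mult_map_apply)
    then show "\<zero>\<^bsub>End_algebra C\<^esub> \<in> ?H" by simp
    show "c \<odot>\<^bsub>End_algebra C\<^esub> a \<in> ?H" if "a \<in> ?H" for c a
    proof -
      obtain y where y: "a = mult_map y" "y \<in> carrier C" using \<open>a \<in> ?H\<close> by (rule imageE)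
      then have "c \<odot>\<^bsub>End_algebra C\<^esub> a = mult_map (c \<odot> y)"
        by (intro X.End_eqI) (auto simp: X.End_apply mult_map_apply smult_mult_left)
      then show ?thesis using y by simp
    qed
  qed (auto simp: X.module_End)
  moreover have "basis_idempotent C d e ` {..d} \<subseteq> ?H"
    by (auto simp: basis_idempotent_e)
  ultimately have "a \<in> ?H" using a A.span_is_subset by blast
  then show "a = mult_map (a \<one>)" "a \<in> carrier (End_algebra C)"
    by (auto simp: mult_map_apply)
qed

text \<open>Both sides of the defining equation kill \<open>e j\<close> for \<open>j\<close> other
  than 0, so only \<open>e 0\<close> matters. There they take the values m_0 a(1) and m_0
  \<open>x i\<close>; cancelling m_0 gives a(1) = \<open>x i\<close>, and an element of the span is
  determined by its value at the unit.\<close>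

lemma system_A_eq:
  assumes i: "i \<le> d"
  shows "system_A (End_algebra C) d (basis_idempotent C d e) (basis_idempotent C d x) i = mult_map (x i)"
  unfolding system_A_def
proof (rule the_equality, intro conjI)
  interpret A: class_vectorspace "End_algebra C"
    using X.vectorspace_End by (rule class_vectorspace.intro)
  let ?A = "End_algebra C" and ?E = "basis_idempotent C d e" and ?Es = "basis_idempotent C d x"
  have E_e: "?E 0 (e 0) = e 0"
    by (simp add: Y.basis_idempotent_apply Y.coord_u)
  have Es_e: "?Es j (e 0) = X.coord 0 (e 0) \<odot> x j" if "j \<le> d" for j
    using that by (simp add: X.basis_idempotent_apply coord_x_e_zero[OF that])
  show "mult_map (x i) \<in> A.span (?E ` {..d})"
    using i by (subst mult_map_expand) (auto intro!: A.finsum_in_span)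
  show "mult_map (x i) \<otimes>\<^bsub>?A\<^esub> ?Es 0 \<otimes>\<^bsub>?A\<^esub> ?E 0 = ?Es i \<otimes>\<^bsub>?A\<^esub> ?E 0"
  proof (rule Y.End_eqI_basis)
    fix j assume j: "j \<le> d"
    show "(mult_map (x i) \<otimes>\<^bsub>?A\<^esub> ?Es 0 \<otimes>\<^bsub>?A\<^esub> ?E 0) (e j) = (?Es i \<otimes>\<^bsub>?A\<^esub> ?E 0) (e j)"
    proof (cases "j = 0")
      case True
      then show ?thesis
        using i by (simp add: X.End_apply E_e Es_e mult_map_apply smult_mult_right) (simp add: x_zero)
    next
      case False
      then show ?thesis
        using i j by (simp add: X.End_apply Y.basis_idempotent_apply Y.coord_u X.End_zero_apply)
    qed
  qed (use i in auto)
  fix a assume "a \<in> A.span (?E ` {..d}) \<and> a \<otimes>\<^bsub>?A\<^esub> ?Es 0 \<otimes>\<^bsub>?A\<^esub> ?E 0 = ?Es i \<otimes>\<^bsub>?A\<^esub> ?E 0"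
  then have a: "a = mult_map (a \<one>)" "a \<in> carrier ?A"
    and eq: "(a \<otimes>\<^bsub>?A\<^esub> ?Es 0 \<otimes>\<^bsub>?A\<^esub> ?E 0) (e 0) = (?Es i \<otimes>\<^bsub>?A\<^esub> ?E 0) (e 0)"
    using span_basis_idempotents by auto
  have "X.coord 0 (e 0) \<odot> a \<one> = X.coord 0 (e 0) \<odot> x i"
    using eq i a(2) by (simp add: X.End_apply E_e Es_e X.End_smult) (simp add: x_zero X.End_smult)
  then have "(inverse (X.coord 0 (e 0)) * X.coord 0 (e 0)) \<odot> a \<one> =
      (inverse (X.coord 0 (e 0)) * X.coord 0 (e 0)) \<odot> x i"
    using i a(2) by (simp add: X.smult_assoc1 X.End_closed del: left_inverse)
  then have "a \<one> = x i" using i a(2) coord_x_zero_e[of 0] by (simp add: X.End_closed)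
  then show "a = mult_map (x i)" using a(1) by simp
qed

lemma first_eigenmatrix_eq:
  "first_eigenmatrix (End_algebra C) d (basis_idempotent C d e) (basis_idempotent C d x) = eigenmatrix C d x e"
proof -
  define P where "P = mat (d + 1) (d + 1) (\<lambda>(i, j). Y.coord i (x j))"
  let ?A = "End_algebra C" and ?E = "basis_idempotent C d e"
  \<comment> \<open>The \<open>?E i\<close> need not span the whole endomorphism algebra, so
    uniqueness of the matrix is transferred to \<open>C\<close>: evaluation at the unit carries each
    \<open>?E i\<close> to \<open>e i\<close>.\<close>
  have sum_one: "(\<Oplus>\<^bsub>?A\<^esub>i\<in>{..d}. c i \<odot>\<^bsub>?A\<^esub> ?E i) \<one> = Y.comb c" for c
    by (subst X.End_finsum_apply)
      (auto simp: Y.comb_def X.End_apply basis_idempotent_e_apply intro!: finsum_cong')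
  interpret A: class_vectorspace ?A
    using X.vectorspace_End by (rule class_vectorspace.intro)
  have "first_eigenmatrix ?A d ?E (basis_idempotent C d x) = P"
    unfolding first_eigenmatrix_def transition_matrix_def
  proof (rule the_equality)
    have "mult_map (x j) = (\<Oplus>\<^bsub>?A\<^esub>i\<in>{..d}. P $$ (i, j) \<odot>\<^bsub>?A\<^esub> ?E i)" if "j \<le> d" for j
      using that by (subst mult_map_expand) (auto simp: P_def intro!: A.M.finsum_cong')
    then show "P \<in> carrier_mat (d + 1) (d + 1) \<and>
      (\<forall>j\<le>d. system_A ?A d ?E (basis_idempotent C d x) j = (\<Oplus>\<^bsub>?A\<^esub>i\<in>{..d}. P $$ (i, j) \<odot>\<^bsub>?A\<^esub> ?E i))"
      by (simp add: system_A_eq P_def)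
    fix Q assume Q: "Q \<in> carrier_mat (d + 1) (d + 1) \<and>
      (\<forall>j\<le>d. system_A ?A d ?E (basis_idempotent C d x) j = (\<Oplus>\<^bsub>?A\<^esub>i\<in>{..d}. Q $$ (i, j) \<odot>\<^bsub>?A\<^esub> ?E i))"
    have "x j = Y.comb (\<lambda>i. Q $$ (i, j))" if "j \<le> d" for j
    proof -
      have "mult_map (x j) \<one> = Y.comb (\<lambda>i. Q $$ (i, j))"
        using Q that by (simp add: system_A_eq flip: sum_one)
      then show ?thesis using that by (simp add: mult_map_apply)
    qed
    then show "Q = P" using Q by (intro eq_matI) (auto simp: P_def)
  qed
  moreover have "eigenmatrix C d x e = P"
    unfolding eigenmatrix_def
  proof (rule Y.transition_matrix_eqI)
    fix j assume "j \<le> d"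
    then show "x j = Y.comb (\<lambda>i. P $$ (i, j))"
      by (intro Y.coord_eqI) (auto simp: P_def)
  qed (simp add: P_def)
  ultimately show ?thesis by simp
qed

end

theorem lemma11p5:
  fixes C :: "('f::field, 'c, 'm) module_scheme"
    and d :: nat
    and x e :: "nat \<Rightarrow> 'c"
  assumes "character_system C d x e"
  shows "symmetric_idempotent_system (End_algebra C) d (basis_idempotent C d e) (basis_idempotent C d x) \<and>
         first_eigenmatrix (End_algebra C) d (basis_idempotent C d e) (basis_idempotent C d x)
           = eigenmatrix C d x e"
proof -
  interpret character_system_space C d x e
    using assms by (rule character_system_space.intro)
  show ?thesis
    using symmetric_idempotent_system_End first_eigenmatrix_eq by simp
qed

end
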